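(* Let $M$ be a connected, closed, oriented Riemannian manifold with total volume $1$. Consider pairs $(f,X)$, where $f$ is a power series in $t$ whose coefficients are smooth functions on $M$ and $X$ is a power series in $t$ whose coefficients are one-forms on $M$, and write $\rho=\exp(f)$. Solutions to the equation $$\dot\rho+\delta(\rho X)=0$$ are in bijective correspondence with solutions $(\rho,u)$ to the mass equation $$\dot\rho+\nabla\cdot(\rho u)=0,$$ where $\rho$ is a positive density function and $u$ a velocity vector field on $M$ (both depending on $t$), via the identification of the two $\rho$ variables and $u=X^\sharp$.
   Context: A dot denotes $\partial_t$. Time-dependent objects are power series in the homotopy parameter $t$ with smooth coefficients. $\flat:\Gamma(\Lambda^kTM)\to\Omega^k(M)$ and $\sharp:\Omega^k(M)\to\Gamma(\Lambda^kTM)$ are the mutually inverse musical isomorphisms induced by the metric. With $n=\dim M$ and $\star$ the Hodge star ($\alpha\wedge\star\beta=\langle\alpha,\beta\rangle dV$), the codifferential is $\delta=(-1)^{ni+1}\star d\star:\Omega^i(M)\to\Omega^{i-1}(M)$. The divergence is the operator corresponding to $\delta$ under the musical isomorphism: $\nabla\cdot u=\delta(u^\flat)$ (this is the usual divergence when $n=3$). The equation $\dot\rho+\delta(\rho X)=0$ is the $dt$-component of the condition $\delta\exp(f+X\,dt)=0$, i.e. it is exactly the condition that $f+X\,dt\in\Omega^\bullet(M)[[t,dt]]$ be a homotopy of collections of homotopy random variables parametrized by $\mathbb{R}$; here $t$ has degree $0$, $dt$ has degree $-1$, $d(t)=dt$, and the differential on $\Omega^\bullet(M)[[t,dt]]$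 is the sum of the codifferential and the differential in $t,dt$. *)

theory Defs
  imports
    "HOL-Analysis.Analysis"
    "HOL-Library.Function_Algebras"
    "HOL-Computational_Algebra.Formal_Power_Series"
    "Jordan_Normal_Form.Determinant"
    "Jordan_Normal_Form.DL_Submatrix"
    "Jordan_Normal_Form.Gauss_Jordan_Elimination"
begin

section \<open>Smooth functions on open subsets of coordinate space\<close>

text \<open>
  The coordinate space of dimension \<open>n\<close> consists of the functions on \<open>{..<n}\<close> that are
  \<open>undefined\<close> elsewhere, as in the product measure \<open>PiM {..<n} (\<lambda>_. lborel)\<close>. Its topology is the
  subspace topology inherited from the product topology on \<open>nat \<Rightarrow> real\<close>. Dimension 0 is allowed
  and gives a single point.
\<close>

definition coord_space :: "nat \<Rightarrow> (nat \<Rightarrow> real) set" where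
  "coord_space n = {..<n} \<rightarrow>\<^sub>E UNIV"

definition open_coord :: "nat \<Rightarrow> (nat \<Rightarrow> real) set \<Rightarrow> bool" where
  "open_coord n W \<longleftrightarrow> openin (top_of_set (coord_space n)) W"

definition partial_deriv :: "nat \<Rightarrow> ((nat \<Rightarrow> real) \<Rightarrow> real) \<Rightarrow> (nat \<Rightarrow> real) \<Rightarrow> real" where
  "partial_deriv i h x = deriv (\<lambda>s. h (x(i := s))) (x i)"

text \<open>\<open>Ck_on n k W h\<close>: on the open set \<open>W\<close>, all partial derivatives of \<open>h\<close> of order at most \<open>k\<close>
  exist and are continuous.\<close>

primrec Ck_on :: "nat \<Rightarrow> nat \<Rightarrow> (nat \<Rightarrow> real) set \<Rightarrow> ((nat \<Rightarrow> real) \<Rightarrow> real) \<Rightarrow> bool" where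
  "Ck_on n 0 W h \<longleftrightarrow> continuous_on W h"
| "Ck_on n (Suc k) W h \<longleftrightarrow> continuous_on W h \<and>
     (\<forall>i<n. (\<forall>x\<in>W. (\<lambda>s. h (x(i := s))) field_differentiable at (x i)) \<and>
            Ck_on n k W (partial_deriv i h))"

definition smooth_on :: "nat \<Rightarrow> (nat \<Rightarrow> real) set \<Rightarrow> ((nat \<Rightarrow> real) \<Rightarrow> real) \<Rightarrow> bool" where
  "smooth_on n W h \<longleftrightarrow> (\<forall>k. Ck_on n k W h)"


section \<open>Oriented Riemannian manifolds\<close>

type_synonym 'm chart = "'m set \<times> ('m \<Rightarrow> nat \<Rightarrow> real)"

text \<open>
  The underlying space is the whole type \<open>'m\<close>; the Hausdorff and second countability axioms are
  supplied by its type class. Tensors are given by their components: \<open>metric M c p\<close> is the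
  Gram matrix of the metric at the point \<open>p\<close> in the coordinate frame of the chart \<open>c\<close>.
\<close>

record 'm oriented_riemannian =
  mdim :: nat
  atlas :: "'m chart set"
  metric :: "'m chart \<Rightarrow> 'm \<Rightarrow> real mat"

text \<open>The function \<open>h\<close> expressed in the coordinates of the chart \<open>c\<close>.\<close>

definition in_chart :: "'m chart \<Rightarrow> ('m \<Rightarrow> 'b) \<Rightarrow> (nat \<Rightarrow> real) \<Rightarrow> 'b" where
  "in_chart c h x = h (inv_into (fst c) (snd c) x)"

definition smooth_in_chart :: "nat \<Rightarrow> 'm chart \<Rightarrow> ('m \<Rightarrow> real) \<Rightarrow> bool" where
  "smooth_in_chart n c h \<longleftrightarrow> smooth_on n (snd c ` fst c) (in_chart c h)"

definition is_chart :: "nat \<Rightarrow> ('m::topological_space) chart \<Rightarrow> bool" where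
  "is_chart n c \<longleftrightarrow> open (fst c) \<and> open_coord n (snd c ` fst c) \<and>
     homeomorphism (fst c) (snd c ` fst c) (snd c) (inv_into (fst c) (snd c))"

text \<open>The coordinate change from \<open>c\<close> to \<open>c'\<close> is smooth on the image of the overlap.\<close>

definition smoothly_related :: "nat \<Rightarrow> 'm chart \<Rightarrow> 'm chart \<Rightarrow> bool" where
  "smoothly_related n c c' \<longleftrightarrow>
     (\<forall>i<n. smooth_on n (snd c ` (fst c \<inter> fst c')) (in_chart c (\<lambda>q. snd c' q i)))"

text \<open>Entry \<open>(i,j)\<close> is the derivative of the \<open>i\<close>-th coordinate of \<open>c'\<close> with respect to the
  \<open>j\<close>-th coordinate of \<open>c\<close>.\<close>

definition jacobian :: "nat \<Rightarrow> 'm chart \<Rightarrow> 'm chart \<Rightarrow> 'm \<Rightarrow> real mat" where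
  "jacobian n c c' p =
     mat n n (\<lambda>(i, j). partial_deriv j (in_chart c (\<lambda>q. snd c' q i)) (snd c p))"

definition oriented_smooth_atlas :: "nat \<Rightarrow> ('m::topological_space) chart set \<Rightarrow> bool" where
  "oriented_smooth_atlas n A \<longleftrightarrow>
     (\<Union>c\<in>A. fst c) = UNIV \<and>
     (\<forall>c\<in>A. is_chart n c) \<and>
     (\<forall>c\<in>A. \<forall>c'\<in>A. smoothly_related n c c') \<and>
     (\<forall>c\<in>A. \<forall>c'\<in>A. \<forall>p\<in>fst c \<inter> fst c'. Determinant.det (jacobian n c c' p) > 0)"

definition riemannian_metric ::
    "nat \<Rightarrow> 'm chart set \<Rightarrow> ('m chart \<Rightarrow> 'm \<Rightarrow> real mat) \<Rightarrow> bool" where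
  "riemannian_metric n A g \<longleftrightarrow>
     (\<forall>c\<in>A. \<forall>p\<in>fst c.
        g c p \<in> carrier_mat n n \<and> transpose_mat (g c p) = g c p \<and>
        (\<forall>v\<in>carrier_vec n. v \<noteq> 0\<^sub>v n \<longrightarrow> scalar_prod v (mult_mat_vec (g c p) v) > 0)) \<and>
     (\<forall>c\<in>A. \<forall>i<n. \<forall>j<n. smooth_in_chart n c (\<lambda>p. g c p $$ (i, j))) \<and>
     (\<forall>c\<in>A. \<forall>c'\<in>A. \<forall>p\<in>fst c \<inter> fst c'.
        g c p = transpose_mat (jacobian n c c' p) * g c' p * jacobian n c c' p)"

definition oriented_riemannian_manifold ::
    "('m::{t2_space, second_countable_topology}) oriented_riemannian \<Rightarrow> bool" where
  "oriented_riemannian_manifold M \<longleftrightarrow>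
     oriented_smooth_atlas (mdim M) (atlas M) \<and>
     riemannian_metric (mdim M) (atlas M) (metric M)"

text \<open>The Riemannian volume is the Borel measure that in every chart has density
  \<open>sqrt (det g)\<close> with respect to Lebesgue measure.\<close>

definition volume_measure :: "('m::topological_space) oriented_riemannian \<Rightarrow> 'm measure" where
  "volume_measure M = (THE \<mu>. sets \<mu> = sets borel \<and>
     (\<forall>c\<in>atlas M. \<forall>B\<in>sets borel. B \<subseteq> fst c \<longrightarrow>
        emeasure \<mu> B =
          (\<integral>\<^sup>+ x\<in>snd c ` B. ennreal (sqrt (Determinant.det (in_chart c (metric M c) x)))
             \<partial>(PiM {..<mdim M} (\<lambda>_. lborel)))))"

definition total_volume :: "('m::topological_space) oriented_riemannian \<Rightarrow> ennreal" where
  "total_volume M = emeasure (volume_measure M) UNIV"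


section \<open>Functions, vector fields and differential forms\<close>

text \<open>
  A tensor field assigns components to every chart and every point of its domain, subject to the
  transformation law. The components are set to 0 where they have no meaning, so that equality
  of fields is equality of functions. The components of a vector field are indexed by
  \<open>i < n\<close>, those of a \<open>k\<close>-form by the \<open>k\<close>-element subsets \<open>I\<close> of \<open>{..<n}\<close>: the component \<open>I\<close> is the
  coefficient of the wedge product of the \<open>dx\<^sub>i\<close>, \<open>i \<in> I\<close>, in increasing order.
\<close>

type_synonym 'm vfield = "'m chart \<Rightarrow> 'm \<Rightarrow> nat \<Rightarrow> real"
type_synonym 'm dform = "'m chart \<Rightarrow> 'm \<Rightarrow> nat set \<Rightarrow> real"

definition multi_indices :: "nat \<Rightarrow> nat \<Rightarrow> nat set set" where
  "multi_indices n k = {I. I \<subseteq> {..<n} \<and> card I = k}"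

definition smooth_functions :: "'m oriented_riemannian \<Rightarrow> ('m \<Rightarrow> real) set" where
  "smooth_functions M = {h. \<forall>c\<in>atlas M. smooth_in_chart (mdim M) c h}"

definition vector_fields :: "'m oriented_riemannian \<Rightarrow> 'm vfield set" where
  "vector_fields M = {u.
     (\<forall>c p i. \<not> (c \<in> atlas M \<and> p \<in> fst c \<and> i < mdim M) \<longrightarrow> u c p i = 0) \<and>
     (\<forall>c\<in>atlas M. \<forall>i<mdim M. smooth_in_chart (mdim M) c (\<lambda>p. u c p i)) \<and>
     (\<forall>c\<in>atlas M. \<forall>c'\<in>atlas M. \<forall>p\<in>fst c \<inter> fst c'. \<forall>i<mdim M.
        u c' p i = (\<Sum>j<mdim M. jacobian (mdim M) c c' p $$ (i, j) * u c p j))}"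

definition forms :: "'m oriented_riemannian \<Rightarrow> nat \<Rightarrow> 'm dform set" where
  "forms M k = {\<omega>.
     (\<forall>c p I. \<not> (c \<in> atlas M \<and> p \<in> fst c \<and> I \<in> multi_indices (mdim M) k) \<longrightarrow> \<omega> c p I = 0) \<and>
     (\<forall>c\<in>atlas M. \<forall>I\<in>multi_indices (mdim M) k.
        smooth_in_chart (mdim M) c (\<lambda>p. \<omega> c p I)) \<and>
     (\<forall>c\<in>atlas M. \<forall>c'\<in>atlas M. \<forall>p\<in>fst c \<inter> fst c'. \<forall>I\<in>multi_indices (mdim M) k.
        \<omega> c p I = (\<Sum>J\<in>multi_indices (mdim M) k.
                     Determinant.det (submatrix (jacobian (mdim M) c c' p) J I) * \<omega> c' p J))}"

text \<open>The 0-form given by a function.\<close>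

definition fun_form :: "'m oriented_riemannian \<Rightarrow> ('m \<Rightarrow> real) \<Rightarrow> 'm dform" where
  "fun_form M h = (\<lambda>c p I. if c \<in> atlas M \<and> p \<in> fst c \<and> I = {} then h p else 0)"

text \<open>Multiplication of a vector field or a differential form by a function.\<close>

definition fun_smult ::
    "('m \<Rightarrow> real) \<Rightarrow> ('m chart \<Rightarrow> 'm \<Rightarrow> 'i \<Rightarrow> real) \<Rightarrow> 'm chart \<Rightarrow> 'm \<Rightarrow> 'i \<Rightarrow> real" where
  "fun_smult h T = (\<lambda>c p i. h p * T c p i)"

definition inverse_metric :: "'m oriented_riemannian \<Rightarrow> 'm chart \<Rightarrow> 'm \<Rightarrow> real mat" where
  "inverse_metric M c p = the (mat_inverse (metric M c p))"

definition flat :: "'m oriented_riemannian \<Rightarrow> 'm vfield \<Rightarrow> 'm dform" where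
  "flat M u = (\<lambda>c p I. if c \<in> atlas M \<and> p \<in> fst c \<and> I \<in> multi_indices (mdim M) 1
     then \<Sum>j<mdim M. metric M c p $$ (the_elem I, j) * u c p j else 0)"

definition sharp :: "'m oriented_riemannian \<Rightarrow> 'm dform \<Rightarrow> 'm vfield" where
  "sharp M X = (\<lambda>c p i. if c \<in> atlas M \<and> p \<in> fst c \<and> i < mdim M
     then \<Sum>j<mdim M. inverse_metric M c p $$ (i, j) * X c p {j} else 0)"


section \<open>Exterior algebra of an oriented inner product space\<close>

text \<open>Here \<open>G\<close> is the Gram matrix of the coordinate basis, and covectors of degree \<open>k\<close> are given by
  their components indexed by \<open>multi_indices n k\<close>.\<close>

definition covectors :: "nat \<Rightarrow> nat \<Rightarrow> (nat set \<Rightarrow> real) set" where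
  "covectors n k = {\<alpha>. \<forall>I. I \<notin> multi_indices n k \<longrightarrow> \<alpha> I = 0}"

text \<open>The sign of the permutation sorting \<open>I\<close> followed by \<open>J\<close>, both in increasing order.\<close>

definition shuffle_sign :: "nat set \<Rightarrow> nat set \<Rightarrow> real" where
  "shuffle_sign I J = (-1) ^ card {(i, j). i \<in> I \<and> j \<in> J \<and> j < i}"

definition wedge ::
    "nat \<Rightarrow> (nat set \<Rightarrow> real) \<Rightarrow> (nat set \<Rightarrow> real) \<Rightarrow> nat set \<Rightarrow> real" where
  "wedge n \<alpha> \<beta> = (\<lambda>K. if K \<subseteq> {..<n}
     then \<Sum>I\<in>Pow K. shuffle_sign I (K - I) * \<alpha> I * \<beta> (K - I) else 0)"

definition covector_inner ::
    "nat \<Rightarrow> real mat \<Rightarrow> nat \<Rightarrow> (nat set \<Rightarrow> real) \<Rightarrow> (nat set \<Rightarrow> real) \<Rightarrow> real" where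
  "covector_inner n G k \<alpha> \<beta> =
     (\<Sum>I\<in>multi_indices n k. \<Sum>J\<in>multi_indices n k.
        Determinant.det (submatrix (the (mat_inverse G)) I J) * \<alpha> I * \<beta> J)"

definition volume_covector :: "nat \<Rightarrow> real mat \<Rightarrow> nat set \<Rightarrow> real" where
  "volume_covector n G = (\<lambda>I. if I = {..<n} then sqrt (Determinant.det G) else 0)"

definition hodge_covector ::
    "nat \<Rightarrow> real mat \<Rightarrow> nat \<Rightarrow> (nat set \<Rightarrow> real) \<Rightarrow> nat set \<Rightarrow> real" where
  "hodge_covector n G k \<beta> =
     (if k \<le> n
      then THE \<gamma>. \<gamma> \<in> covectors n (n - k) \<and>
             (\<forall>\<alpha>\<in>covectors n k.
                wedge n \<alpha> \<gamma> = (\<lambda>K. covector_inner n G k \<alpha> \<beta> * volume_covector n G K))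
      else (\<lambda>_. 0))"


section \<open>Exterior derivative, Hodge star, codifferential and divergence\<close>

definition ext_deriv :: "'m oriented_riemannian \<Rightarrow> 'm dform \<Rightarrow> 'm dform" where
  "ext_deriv M \<omega> = (\<lambda>c p K. if c \<in> atlas M \<and> p \<in> fst c \<and> K \<subseteq> {..<mdim M}
     then \<Sum>i\<in>K. shuffle_sign {i} (K - {i}) *
            partial_deriv i (in_chart c (\<lambda>q. \<omega> c q (K - {i}))) (snd c p)
     else 0)"

text \<open>The Hodge star on \<open>k\<close>-forms.\<close>

definition hodge_star :: "'m oriented_riemannian \<Rightarrow> nat \<Rightarrow> 'm dform \<Rightarrow> 'm dform" where
  "hodge_star M k \<omega> = (\<lambda>c p. if c \<in> atlas M \<and> p \<in> fst c
     then hodge_covector (mdim M) (metric M c p) k (\<omega> c p) else (\<lambda>_. 0))"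

text \<open>The codifferential on \<open>i\<close>-forms, \<open>i \<ge> 1\<close>. For \<open>i = 1\<close> the sign makes it the usual divergence
  (rather than its negative) in dimension 3. The second Hodge star acts on forms of degree
  \<open>n - i + 1\<close>, written \<open>Suc n - i\<close> so that truncated subtraction does no harm when \<open>n = 0\<close>.\<close>

definition codiff :: "'m oriented_riemannian \<Rightarrow> nat \<Rightarrow> 'm dform \<Rightarrow> 'm dform" where
  "codiff M i \<omega> = fun_smult (\<lambda>_. (-1) ^ (mdim M * i + 1))
     (hodge_star M (Suc (mdim M) - i) (ext_deriv M (hodge_star M i \<omega>)))"

definition divergence :: "'m oriented_riemannian \<Rightarrow> 'm vfield \<Rightarrow> 'm dform" where
  "divergence M u = codiff M 1 (flat M u)"


section \<open>Power series in the homotopy parameter\<close>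

text \<open>Power series in \<open>t\<close> have type \<open>_ fps\<close>, where the coefficients are functions or tensor fields
  with the pointwise operations of \<open>Function_Algebras\<close>; \<open>fps_deriv\<close> is the derivative in \<open>t\<close>.\<close>

definition series_over :: "'a::zero set \<Rightarrow> 'a fps set" where
  "series_over S = {F. \<forall>k. fps_nth F k \<in> S}"

text \<open>Extension of an operator to power series coefficient by coefficient.\<close>

definition series_map :: "('a::zero \<Rightarrow> 'b::zero) \<Rightarrow> 'a fps \<Rightarrow> 'b fps" where
  "series_map T F = Abs_fps (\<lambda>k. T (fps_nth F k))"

definition series_smult ::
    "('m \<Rightarrow> real) fps \<Rightarrow> ('m chart \<Rightarrow> 'm \<Rightarrow> 'i \<Rightarrow> real) fps \<Rightarrow> ('m chart \<Rightarrow> 'm \<Rightarrow> 'i \<Rightarrow> real) fps"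
  where
  "series_smult h F =
     Abs_fps (\<lambda>k. \<Sum>i\<le>k. fun_smult (fps_nth h i) (fps_nth F (k - i)))"

text \<open>The exponential series. The constant coefficient of \<open>f\<close> need not vanish, so the coefficients of
  the sum are convergent series of real numbers at every point.\<close>

definition series_exp :: "('m \<Rightarrow> real) fps \<Rightarrow> ('m \<Rightarrow> real) fps" where
  "series_exp f = Abs_fps (\<lambda>k p. \<Sum>j. fps_nth (f ^ j) k p / fact j)"

text \<open>A power series of functions is positive if its value at \<open>t = 0\<close> is. No normalisation of the
  total mass is imposed.\<close>

definition positive_series :: "('m \<Rightarrow> real) fps \<Rightarrow> bool" where
  "positive_series \<rho> \<longleftrightarrow> (\<forall>p. fps_nth \<rho> 0 p > 0)"

definition homotopy_solutions ::
    "'m oriented_riemannian \<Rightarrow> (('m \<Rightarrow> real) fps \<times> 'm dform fps) set" where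
  "homotopy_solutions M = {(f, X).
     f \<in> series_over (smooth_functions M) \<and> X \<in> series_over (forms M 1) \<and>
     series_map (fun_form M) (fps_deriv (series_exp f)) +
       series_map (codiff M 1) (series_smult (series_exp f) X) = 0}"

definition mass_solutions ::
    "'m oriented_riemannian \<Rightarrow> (('m \<Rightarrow> real) fps \<times> 'm vfield fps) set" where
  "mass_solutions M = {(\<rho>, u).
     \<rho> \<in> series_over (smooth_functions M) \<and> positive_series \<rho> \<and>
     u \<in> series_over (vector_fields M) \<and>
     series_map (fun_form M) (fps_deriv \<rho>) +
       series_map (divergence M) (series_smult \<rho> u) = 0}"

end

theory Submission
  imports Defs
begin

text \<open>
  The correspondence splits into two independent bijections, between \<open>f\<close> and \<open>\<rho>\<close> and between \<open>X\<close> and \<open>u\<close>,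
  and an observation that identifies the two equations.

  The divergence of \<open>\<rho> u\<close> is by definition the codifferential of \<open>(\<rho> u)\<^sup>\<flat>\<close>. Lowering the index is linear
  over functions, so \<open>(\<rho> u)\<^sup>\<flat> = \<rho> u\<^sup>\<flat>\<close> (\<open>series_divergence\<close>), and with \<open>X = u\<^sup>\<flat>\<close> the two equations are
  literally the same.

  The musical isomorphisms are given in each chart by the Gram matrix and its inverse, hence are
  mutually inverse (\<open>flat_sharp\<close>, \<open>sharp_flat\<close>). That they preserve the transformation laws is matrix
  algebra with the Jacobian; that they preserve smoothness rests on Cramer's rule for the entries of the
  inverse Gram matrix (\<open>flat_in_forms\<close>, \<open>sharp_in_vector_fields\<close>).

  The exponential is a bijection from smooth power series onto positive smooth ones. At each point
  of \<open>M\<close> it is the exponential \<open>E\<close> of a real power series \<open>g\<close>, which is determined by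
  the differential equation \<open>E' = g' * E\<close> and the initial value \<open>exp g\<^sub>0\<close> (\<open>fps_deriv_Exp\<close>,
  \<open>fps_Exp_nth_0\<close>). Hence \<open>g\<close> is recovered by integrating \<open>E' / E\<close> from \<open>ln E\<^sub>0\<close>, and every series with
  positive constant coefficient arises (\<open>fps_Log_Exp\<close>, \<open>fps_Exp_Log\<close>). Comparing coefficients in the
  differential equation gives finite recursions for the coefficients of \<open>E\<close> and of \<open>g\<close>, in which only
  ring operations and the functions \<open>exp\<close>, \<open>ln\<close> and reciprocal of constant coefficients occur.
  As smooth functions are closed under these, the exponential and the logarithm preserve smoothness
  (\<open>smooth_series_exp\<close>, \<open>smooth_series_log\<close>).
\<close>

section \<open>Calculus of smooth functions\<close>

text \<open>
  A point of an open set may be moved a little in a single coordinate direction. The partial derivatives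
  at a point of the set therefore see only values on the set, which is why regularity on an open set
  depends only on the restriction of the function to it.
\<close>
lemma eventually_fun_upd_mem:
  assumes "open_coord n W" "x \<in> W" "i < n"
  shows "\<forall>\<^sub>F s in nhds (x i). x(i := s) \<in> W"
proof -
  obtain T where T: "open T" "W = coord_space n \<inter> T"
    using assms(1) by (auto simp: open_coord_def openin_open)
  have "continuous_on UNIV (\<lambda>s. (x(i := s)) j)" for j
    by (cases "j = i") auto
  then have "continuous_on UNIV (\<lambda>s. x(i := s))"
    by (rule continuous_on_coordinatewise_then_product)
  then have "open ((\<lambda>s. x(i := s)) -` T)"
    using T(1) by (simp add: continuous_on_open_vimage)
  moreover have "x i \<in> (\<lambda>s. x(i := s)) -` T"
    using assms(2) T by simp
  ultimately have "\<forall>\<^sub>F s in nhds (x i). x(i := s) \<in> T"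
    using eventually_nhds_in_open[of "(\<lambda>s. x(i := s)) -` T" "x i"] by simp
  moreover have "x(i := s) \<in> coord_space n" for s
    using assms(2,3) T by (auto simp: coord_space_def PiE_def extensional_def)
  ultimately show ?thesis
    using T(2) by (auto elim: eventually_mono)
qed

lemma Ck_on_cong:
  assumes "open_coord n W" "\<And>x. x \<in> W \<Longrightarrow> h x = h' x" "Ck_on n k W h"
  shows "Ck_on n k W h'"
  using assms(2,3)
proof (induction k arbitrary: h h')
  case 0
  then show ?case by (simp cong: continuous_on_cong)
next
  case (Suc k)
  have ev: "\<forall>\<^sub>F s in nhds (x i). h (x(i := s)) = h' (x(i := s))" if "x \<in> W" "i < n" for x i
    using eventually_fun_upd_mem[OF assms(1) that] by (rule eventually_mono) (rule Suc.prems(1))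
  have "partial_deriv i h x = partial_deriv i h' x" if "x \<in> W" "i < n" for x i
    unfolding partial_deriv_def by (rule deriv_cong_ev[OF ev[OF that]]) simp
  then have "Ck_on n k W (partial_deriv i h')" if "i < n" for i
    using Suc.IH[of "partial_deriv i h" "partial_deriv i h'"] Suc.prems(2) that by simp
  moreover have "(\<lambda>s. h' (x(i := s))) field_differentiable at (x i)" if "x \<in> W" "i < n" for x i
  proof -
    have "(\<lambda>s. h (x(i := s))) field_differentiable at (x i)"
      using Suc.prems(2) that by simp
    then show ?thesis
      unfolding field_differentiable_def DERIV_cong_ev[OF refl ev[OF that] refl] .
  qed
  moreover have "continuous_on W h'"
    using Suc.prems by (simp cong: continuous_on_cong)
  ultimately show ?case
    by simp
qed

lemma Ck_on_Suc_imp: "Ck_on n (Suc k) W h \<Longrightarrow> Ck_on n k W h"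
  by (induction k arbitrary: h) auto

text \<open>
  The partial derivatives are defined through the total operator \<open>deriv\<close>, which is awkward to
  compute with. This rule accepts any functions that are the partial derivatives on the set, whatever
  they are elsewhere.
\<close>
lemma Ck_on_SucI:
  assumes W: "open_coord n W" and cont: "continuous_on W h"
    and deriv: "\<And>i x. i < n \<Longrightarrow> x \<in> W \<Longrightarrow>
                  ((\<lambda>s. h (x(i := s))) has_field_derivative D i x) (at (x i))"
    and D: "\<And>i. i < n \<Longrightarrow> Ck_on n k W (D i)"
  shows "Ck_on n (Suc k) W h"
proof -
  have "Ck_on n k W (partial_deriv i h)" if i: "i < n" for i
    by (rule Ck_on_cong[OF W _ D[OF i]])
      (use i in \<open>simp add: partial_deriv_def DERIV_imp_deriv[OF deriv]\<close>)
  then show ?thesis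
    using cont deriv by (auto simp: field_differentiable_def)
qed

lemma Ck_on_SucD:
  assumes "Ck_on n (Suc k) W h" "i < n"
  shows "Ck_on n k W (partial_deriv i h)"
    and "x \<in> W \<Longrightarrow>
      ((\<lambda>s. h (x(i := s))) has_field_derivative partial_deriv i h x) (at (x i))"
  using assms by (auto simp: partial_deriv_def field_differentiable_derivI)

lemma Ck_on_const:
  assumes "open_coord n W"
  shows "Ck_on n k W (\<lambda>_. a)"
proof (induction k arbitrary: a)
  case (Suc k)
  show ?case
    by (rule Ck_on_SucI[OF assms, where D = "\<lambda>_ _. 0"]) (auto intro: Suc)
qed simp

lemma Ck_on_add:
  assumes "open_coord n W" "Ck_on n k W h" "Ck_on n k W h'"
  shows "Ck_on n k W (\<lambda>x. h x + h' x)"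
  using assms(2,3)
proof (induction k arbitrary: h h')
  case 0
  then show ?case by (simp add: continuous_on_add)
next
  case (Suc k)
  show ?case
  proof (rule Ck_on_SucI[OF assms(1)])
    show "continuous_on W (\<lambda>x. h x + h' x)"
      using Suc.prems by (simp add: continuous_on_add)
    fix i x assume i: "i < n"
    show "Ck_on n k W (\<lambda>x. partial_deriv i h x + partial_deriv i h' x)"
      by (intro Suc.IH Ck_on_SucD(1)[OF _ i] Suc.prems)
    assume "x \<in> W"
    then show "((\<lambda>s. h (x(i := s)) + h' (x(i := s))) has_field_derivative
        partial_deriv i h x + partial_deriv i h' x) (at (x i))"
      by (intro DERIV_add Ck_on_SucD(2)[OF Suc.prems(1) i] Ck_on_SucD(2)[OF Suc.prems(2) i])
  qed
qed

lemma Ck_on_mult: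
  assumes "open_coord n W" "Ck_on n k W h" "Ck_on n k W h'"
  shows "Ck_on n k W (\<lambda>x. h x * h' x)"
  using assms(2,3)
proof (induction k arbitrary: h h')
  case 0
  then show ?case by (simp add: continuous_on_mult)
next
  case (Suc k)
  show ?case
  proof (rule Ck_on_SucI[OF assms(1)])
    show "continuous_on W (\<lambda>x. h x * h' x)"
      using Suc.prems by (simp add: continuous_on_mult)
    fix i x assume i: "i < n"
    show "Ck_on n k W (\<lambda>x. partial_deriv i h x * h' x + partial_deriv i h' x * h x)"
      by (intro Ck_on_add Suc.IH Ck_on_SucD(1)[OF _ i] Suc.prems assms(1) Ck_on_Suc_imp[of n k])
    assume "x \<in> W"
    then have "((\<lambda>s. h (x(i := s)) * h' (x(i := s))) has_field_derivative
        partial_deriv i h x * h' (x(i := x i)) + partial_deriv i h' x * h (x(i := x i))) (at (x i))"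
      by (intro DERIV_mult Ck_on_SucD(2)[OF Suc.prems(1) i] Ck_on_SucD(2)[OF Suc.prems(2) i])
    then show "((\<lambda>s. h (x(i := s)) * h' (x(i := s))) has_field_derivative
        partial_deriv i h x * h' x + partial_deriv i h' x * h x) (at (x i))"
      by simp
  qed
qed

text \<open>
  The chain rule expresses the first partial derivatives of \<open>\<phi> \<circ> h\<close> through \<open>\<phi>' \<circ> h\<close>, so one order of
  differentiability is gained whenever \<open>\<phi>' \<circ> h\<close> is known to be as regular as \<open>\<phi> \<circ> h\<close>. The last premise
  says just that; it holds because \<open>\<phi>'\<close> is a polynomial in \<open>\<phi>\<close> (exponential, reciprocal) or is already
  known to give a smooth composite (logarithm).
\<close>
lemma smooth_on_compose:
  assumes W: "open_coord n W" and h: "smooth_on n W h"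
    and \<phi>: "\<And>x. x \<in> W \<Longrightarrow> (\<phi> has_field_derivative \<phi>' (h x)) (at (h x))"
    and \<phi>': "\<And>k. Ck_on n k W (\<lambda>x. \<phi> (h x)) \<Longrightarrow> Ck_on n k W (\<lambda>x. \<phi>' (h x))"
  shows "smooth_on n W (\<lambda>x. \<phi> (h x))"
  unfolding smooth_on_def
proof
  have hk: "Ck_on n k W h" for k
    using h by (simp add: smooth_on_def)
  have "continuous_on (h ` W) \<phi>"
    using \<phi> by (force intro: continuous_at_imp_continuous_on DERIV_isCont)
  then have cont: "continuous_on W (\<lambda>x. \<phi> (h x))"
    using continuous_on_compose2 hk[of 0] by auto
  fix k
  show "Ck_on n k W (\<lambda>x. \<phi> (h x))"
  proof (induction k)
    case 0
    show ?case using cont by simp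
  next
    case (Suc k)
    show ?case
    proof (rule Ck_on_SucI[OF W cont])
      fix i x assume i: "i < n"
      show "Ck_on n k W (\<lambda>x. \<phi>' (h x) * partial_deriv i h x)"
        by (intro Ck_on_mult W \<phi>' Suc Ck_on_SucD(1)[OF hk i])
      assume "x \<in> W"
      then show "((\<lambda>s. \<phi> (h (x(i := s)))) has_field_derivative \<phi>' (h x) * partial_deriv i h x) (at (x i))"
        using Ck_on_SucD(2)[OF hk i, of x] \<phi>[of x] by (intro DERIV_chain2) auto
    qed
  qed
qed

lemma smooth_on_const: "open_coord n W \<Longrightarrow> smooth_on n W (\<lambda>_. a)"
  by (simp add: smooth_on_def Ck_on_const)

lemma smooth_on_mult:
  "open_coord n W \<Longrightarrow> smooth_on n W h \<Longrightarrow> smooth_on n W h' \<Longrightarrow> smooth_on n W (\<lambda>x. h x * h' x)"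
  by (simp add: smooth_on_def Ck_on_mult)

lemma smooth_on_add:
  "open_coord n W \<Longrightarrow> smooth_on n W h \<Longrightarrow> smooth_on n W h' \<Longrightarrow> smooth_on n W (\<lambda>x. h x + h' x)"
  by (simp add: smooth_on_def Ck_on_add)

lemma smooth_on_exp:
  assumes "open_coord n W" "smooth_on n W h"
  shows "smooth_on n W (\<lambda>x. exp (h x))"
  by (rule smooth_on_compose[OF assms, where \<phi>' = exp]) (auto intro: DERIV_exp)

lemma smooth_on_inverse:
  assumes W: "open_coord n W" and h: "smooth_on n W h" and nz: "\<And>x. x \<in> W \<Longrightarrow> h x \<noteq> 0"
  shows "smooth_on n W (\<lambda>x. inverse (h x))"
proof (rule smooth_on_compose[OF W h, where \<phi>' = "\<lambda>y. - 1 * (inverse y * inverse y)"])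
  show "(inverse has_field_derivative - 1 * (inverse (h x) * inverse (h x))) (at (h x))"
    if "x \<in> W" for x
    using DERIV_inverse[OF nz[OF that]] by (simp add: power2_eq_square)
qed (intro Ck_on_mult Ck_on_const W)

lemma smooth_on_ln:
  assumes W: "open_coord n W" and h: "smooth_on n W h" and pos: "\<And>x. x \<in> W \<Longrightarrow> h x > 0"
  shows "smooth_on n W (\<lambda>x. ln (h x))"
proof (rule smooth_on_compose[OF W h, where \<phi>' = inverse])
  show "(ln has_field_derivative inverse (h x)) (at (h x))" if "x \<in> W" for x
    using DERIV_ln[OF pos[OF that]] .
  show "Ck_on n k W (\<lambda>x. inverse (h x))" for k
    using smooth_on_inverse[OF W h] pos by (force simp: smooth_on_def)
qed

section \<open>Exponential and logarithm of real power series\<close>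

text \<open>
  Evaluation at a point turns a power series of functions into a power series of numbers and is a ring
  homomorphism. The exponential is defined pointwise, so its algebra takes place over the real numbers;
  only the smoothness of the coefficients involves several points at once.
\<close>
definition eval_at :: "'a \<Rightarrow> ('a \<Rightarrow> 'b::zero) fps \<Rightarrow> 'b fps" where
  "eval_at p F = Abs_fps (\<lambda>k. fps_nth F k p)"

lemma eval_at_nth [simp]: "fps_nth (eval_at p F) k = fps_nth F k p"
  by (simp add: eval_at_def)

lemma sum_fun_apply: "(\<Sum>i\<in>I. F i) p = (\<Sum>i\<in>I. F i p)"
  by (induction I rule: infinite_finite_induct) auto

lemma eval_at_power:
  fixes F :: "('a \<Rightarrow> 'b::comm_ring_1) fps"
  shows "eval_at p (F ^ j) = eval_at p F ^ j"
proof (induction j)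
  case 0
  show ?case by (rule fps_ext) simp
next
  case (Suc j)
  have "eval_at p (F * F ^ j) = eval_at p F * eval_at p (F ^ j)"
    by (rule fps_ext) (simp add: fps_mult_nth sum_fun_apply)
  then show ?case using Suc by simp
qed

text \<open>
  The exponential of a real power series whose constant coefficient need not vanish. Each
  coefficient is then a convergent infinite series of real numbers, and the exponential is not a formal
  composition with the exponential series.
\<close>
definition fps_Exp :: "real fps \<Rightarrow> real fps" where
  "fps_Exp g = Abs_fps (\<lambda>k. \<Sum>j. fps_nth (g ^ j) k / fact j)"

lemma series_exp_nth: "fps_nth (series_exp f) k p = fps_nth (fps_Exp (eval_at p f)) k"
  by (simp add: series_exp_def fps_Exp_def flip: eval_at_power)

text \<open>
  The sum of the absolute values of the first \<open>k + 1\<close> coefficients is a submultiplicative seminorm: all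
  products of coefficients that contribute to the product in degrees at most \<open>k\<close> occur among
  the terms of the product of the two sums.
\<close>
lemma abs_fps_power_nth_le:
  fixes g :: "real fps"
  shows "(\<Sum>i\<le>k. \<bar>fps_nth (g ^ j) i\<bar>) \<le> (\<Sum>i\<le>k. \<bar>fps_nth g i\<bar>) ^ j"
proof (induction j)
  case 0
  have "(\<Sum>i\<le>k. \<bar>if i = 0 then 1 else 0 :: real\<bar>) = 1"
    by (subst sum.remove[of _ 0]) auto
  then show ?case by simp
next
  case (Suc j)
  let ?T = "{(i, l). i + l \<le> k}"
  have "(\<Sum>m\<le>k. \<bar>fps_nth (g ^ Suc j) m\<bar>) \<le> (\<Sum>m\<le>k. \<Sum>i\<le>m. \<bar>fps_nth g i\<bar> * \<bar>fps_nth (g ^ j) (m - i)\<bar>)"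
    by (intro sum_mono) (auto simp: fps_mult_nth atLeast0AtMost abs_mult[symmetric] sum_abs)
  also have "\<dots> = (\<Sum>(i, l)\<in>?T. \<bar>fps_nth g i\<bar> * \<bar>fps_nth (g ^ j) l\<bar>)"
    by (rule sum.triangle_reindex_eq[symmetric])
  also have "\<dots> \<le> (\<Sum>(i, l)\<in>{..k} \<times> {..k}. \<bar>fps_nth g i\<bar> * \<bar>fps_nth (g ^ j) l\<bar>)"
    by (intro sum_mono2) auto
  also have "\<dots> = (\<Sum>i\<le>k. \<bar>fps_nth g i\<bar>) * (\<Sum>l\<le>k. \<bar>fps_nth (g ^ j) l\<bar>)"
    by (simp add: sum_product sum.cartesian_product)
  also have "\<dots> \<le> (\<Sum>i\<le>k. \<bar>fps_nth g i\<bar>) * (\<Sum>i\<le>k. \<bar>fps_nth g i\<bar>) ^ j"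
    by (intro mult_left_mono Suc.IH sum_nonneg) auto
  finally show ?case by simp
qed

text \<open>
  By submultiplicativity the \<open>j\<close>-th term is dominated by \<open>N ^ j / fact j\<close> for the seminorm \<open>N\<close> of \<open>g\<close>,
  so the sum converges absolutely like the usual exponential series.
\<close>
lemma summable_fps_Exp: "summable (\<lambda>j. fps_nth (g ^ j) k / fact j)" for g :: "real fps"
proof (rule summable_comparison_test')
  let ?N = "\<Sum>i\<le>k. \<bar>fps_nth g i\<bar>"
  show "summable (\<lambda>j. ?N ^ j / fact j)"
    using summable_exp[of ?N] by (simp add: field_simps)
  fix j :: nat
  have "\<bar>fps_nth (g ^ j) k\<bar> \<le> (\<Sum>i\<le>k. \<bar>fps_nth (g ^ j) i\<bar>)"
    by (rule member_le_sum) auto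
  then show "norm (fps_nth (g ^ j) k / fact j) \<le> ?N ^ j / fact j"
    using abs_fps_power_nth_le[of g j k] by (auto intro: divide_right_mono)
qed

lemma fps_Exp_nth_0: "fps_nth (fps_Exp g) 0 = exp (fps_nth g 0)"
  by (simp add: fps_Exp_def fps_power_zeroth exp_def field_simps)

text \<open>
  Differentiate term by term: the derivative of \<open>g ^ (j + 1) / fact (j + 1)\<close> is \<open>g' * g ^ j / fact j\<close>. In
  each degree the product with \<open>g'\<close> is a finite sum, which commutes with the infinite sum over
  \<open>j\<close>. Together with the value at 0 this differential equation characterises the exponential, and
  everything later uses only these two facts.
\<close>
lemma fps_deriv_Exp: "fps_deriv (fps_Exp g) = fps_deriv g * fps_Exp g"
proof (rule fps_ext)
  fix k
  let ?c = "\<lambda>j k. fps_nth (g ^ j) k / fact j"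
  have step: "of_nat (Suc k) * ?c (Suc j) (Suc k)
      = (\<Sum>i\<le>k. fps_nth (fps_deriv g) i * ?c j (k - i))" for j
  proof -
    have "of_nat (Suc k) * fps_nth (g ^ Suc j) (Suc k) = fps_nth (fps_deriv (g ^ Suc j)) k"
      by (simp only: fps_deriv_nth Suc_eq_plus1)
    also have "\<dots> = of_nat (Suc j) * (\<Sum>i\<le>k. fps_nth (fps_deriv g) i * fps_nth (g ^ j) (k - i))"
      unfolding fps_deriv_power
      by (simp only: mult.assoc fps_mult_left_const_nth diff_Suc_1)
        (simp add: fps_mult_nth atLeast0AtMost)
    finally have "of_nat (Suc k) * fps_nth (g ^ Suc j) (Suc k) / fact (Suc j)
      = of_nat (Suc j) * (\<Sum>i\<le>k. fps_nth (fps_deriv g) i * fps_nth (g ^ j) (k - i)) / fact (Suc j)"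
      by simp
    also have "\<dots> = (\<Sum>i\<le>k. fps_nth (fps_deriv g) i * fps_nth (g ^ j) (k - i)) / fact j"
      by (simp del: of_nat_Suc)
    finally show ?thesis
      by (simp only: sum_divide_distrib times_divide_eq_right)
  qed
  have "fps_nth (fps_deriv (fps_Exp g)) k = of_nat (Suc k) * (\<Sum>j. ?c j (Suc k))"
    by (simp add: fps_Exp_def)
  also have "(\<Sum>j. ?c j (Suc k)) = (\<Sum>j. ?c (Suc j) (Suc k))"
    using suminf_split_head[OF summable_fps_Exp[of g "Suc k"]] by simp
  also have "of_nat (Suc k) * \<dots> = (\<Sum>j. of_nat (Suc k) * ?c (Suc j) (Suc k))"
    using summable_fps_Exp[of g "Suc k"] summable_Suc_iff[of "\<lambda>j. ?c j (Suc k)"]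
    by (subst suminf_mult) auto
  also have "\<dots> = (\<Sum>j. \<Sum>i\<le>k. fps_nth (fps_deriv g) i * ?c j (k - i))"
    by (simp only: step)
  also have "\<dots> = (\<Sum>i\<le>k. \<Sum>j. fps_nth (fps_deriv g) i * ?c j (k - i))"
    by (rule suminf_sum) (intro summable_mult summable_fps_Exp)
  also have "\<dots> = (\<Sum>i\<le>k. fps_nth (fps_deriv g) i * fps_nth (fps_Exp g) (k - i))"
    by (intro sum.cong refl) (simp only: fps_Exp_def fps_nth_Abs_fps suminf_mult[OF summable_fps_Exp])
  finally show "fps_nth (fps_deriv (fps_Exp g)) k = fps_nth (fps_deriv g * fps_Exp g) k"
    by (simp add: fps_mult_nth atLeast0AtMost)
qed

text \<open>
  The logarithm integrates the logarithmic derivative, starting from the logarithm of the constant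
  coefficient.
\<close>
definition fps_Log :: "real fps \<Rightarrow> real fps" where
  "fps_Log r = fps_integral (fps_deriv r * inverse r) (ln (fps_nth r 0))"

lemma fps_Log_Exp: "fps_Log (fps_Exp g) = g"
proof -
  have "fps_Exp g * inverse (fps_Exp g) = 1"
    by (simp add: fps_Exp_nth_0 inverse_mult_eq_1')
  then have "fps_deriv (fps_Exp g) * inverse (fps_Exp g) = fps_deriv g"
    by (simp add: fps_deriv_Exp mult.assoc)
  then show ?thesis
    by (simp add: fps_Log_def fps_Exp_nth_0 fps_integral_deriv)
qed

text \<open>
  With \<open>L\<close> the logarithm of \<open>r\<close>, both \<open>r\<close> and the exponential of \<open>L\<close> solve the linear equation
  \<open>y' = L' * y\<close> with the same initial value, hence their quotient has derivative 0 and constant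
  coefficient 1.
\<close>
lemma fps_Exp_Log:
  assumes "fps_nth r 0 > 0"
  shows "fps_Exp (fps_Log r) = r"
proof -
  let ?q = "fps_Exp (fps_Log r) * inverse r"
  have r: "r * inverse r = 1"
    using assms by (simp add: inverse_mult_eq_1')
  have "fps_deriv ?q = 0"
    using assms
    by (simp add: fps_deriv_Exp fps_Log_def fps_deriv_fps_integral fps_inverse_deriv power2_eq_square
        algebra_simps)
  then have "?q = fps_const (fps_nth ?q 0)"
    by (simp only: fps_deriv_eq_0_iff)
  also have "fps_nth ?q 0 = 1"
    using assms by (simp add: fps_Exp_nth_0 fps_Log_def)
  finally have "?q * r = r" by simp
  then show ?thesis
    using r by (simp add: mult.assoc mult.commute[of "inverse r"])
qed


text \<open>
  Read off coefficient by coefficient, the differential equation computes each coefficient of the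
  exponential from earlier ones by finitely many ring operations. It is the reason
  why the coefficients inherit smoothness, which is not visible from the defining infinite sum.
\<close>
lemma fps_Exp_nth_Suc:
  "fps_nth (fps_Exp g) (Suc k) =
     inverse (real (Suc k)) * (\<Sum>i\<le>k. real (Suc i) * (fps_nth g (Suc i) * fps_nth (fps_Exp g) (k - i)))"
proof -
  have "real (Suc k) * fps_nth (fps_Exp g) (Suc k) = fps_nth (fps_deriv g * fps_Exp g) k"
    by (simp flip: fps_deriv_Exp)
  also have "\<dots> = (\<Sum>i\<le>k. real (Suc i) * (fps_nth g (Suc i) * fps_nth (fps_Exp g) (k - i)))"
    by (simp add: fps_mult_nth atLeast0AtMost mult.assoc)
  finally show ?thesis
    by (simp add: field_simps del: of_nat_Suc)
qed

lemma fps_Log_nth_0: "fps_nth (fps_Log r) 0 = ln (fps_nth r 0)"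
  by (simp add: fps_Log_def)

text \<open>
  The recursion for the exponential solved for the highest coefficient of the exponent, which occurs
  in it multiplied by the constant coefficient of \<open>r\<close>.
\<close>
lemma fps_Log_nth_Suc:
  assumes "fps_nth r 0 > 0"
  shows "fps_nth (fps_Log r) (Suc k) = inverse (fps_nth r 0) *
    (fps_nth r (Suc k) + - inverse (real (Suc k)) *
      (\<Sum>i<k. real (Suc i) * (fps_nth (fps_Log r) (Suc i) * fps_nth r (k - i))))"
  using fps_Exp_nth_Suc[of "fps_Log r" k] assms
  by (simp add: fps_Exp_Log[OF assms] field_simps lessThan_Suc_atMost[symmetric] del: of_nat_Suc)

section \<open>Smooth functions in a chart\<close>

lemma smooth_in_chart_cong:
  assumes "is_chart n c" "\<And>p. p \<in> fst c \<Longrightarrow> h p = h' p" "smooth_in_chart n c h'"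
  shows "smooth_in_chart n c h"
  using assms(3) unfolding smooth_in_chart_def smooth_on_def
proof (intro allI)
  fix k
  assume *: "\<forall>k. Ck_on n k (snd c ` fst c) (in_chart c h')"
  show "Ck_on n k (snd c ` fst c) (in_chart c h)"
  proof (rule Ck_on_cong)
    show "open_coord n (snd c ` fst c)"
      using assms(1) by (simp add: is_chart_def)
    show "in_chart c h' x = in_chart c h x" if "x \<in> snd c ` fst c" for x
      using assms(2)[OF inv_into_into[OF that]] by (simp add: in_chart_def)
  qed (use * in blast)
qed

context
  fixes n and c :: "('m::topological_space) chart"
  assumes c: "is_chart n c"
begin

lemma smooth_in_chart_const: "smooth_in_chart n c (\<lambda>_. a)"
  using c by (simp add: smooth_in_chart_def in_chart_def[abs_def] is_chart_def smooth_on_const)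

lemma smooth_in_chart_mult:
  "smooth_in_chart n c h \<Longrightarrow> smooth_in_chart n c h' \<Longrightarrow> smooth_in_chart n c (\<lambda>p. h p * h' p)"
  using c by (simp add: smooth_in_chart_def in_chart_def[abs_def] is_chart_def smooth_on_mult)

lemma smooth_in_chart_add:
  "smooth_in_chart n c h \<Longrightarrow> smooth_in_chart n c h' \<Longrightarrow> smooth_in_chart n c (\<lambda>p. h p + h' p)"
  using c by (simp add: smooth_in_chart_def in_chart_def[abs_def] is_chart_def smooth_on_add)

lemma smooth_in_chart_exp:
  "smooth_in_chart n c h \<Longrightarrow> smooth_in_chart n c (\<lambda>p. exp (h p))"
  using c by (simp add: smooth_in_chart_def in_chart_def[abs_def] is_chart_def smooth_on_exp)

lemma smooth_in_chart_inverse: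
  assumes "smooth_in_chart n c h" "\<And>p. p \<in> fst c \<Longrightarrow> h p \<noteq> 0"
  shows "smooth_in_chart n c (\<lambda>p. inverse (h p))"
proof -
  have "in_chart c h x \<noteq> 0" if "x \<in> snd c ` fst c" for x
    using assms(2)[OF inv_into_into[OF that]] by (simp add: in_chart_def)
  then have "smooth_on n (snd c ` fst c) (\<lambda>x. inverse (in_chart c h x))"
    using c assms(1) by (simp add: smooth_on_inverse smooth_in_chart_def is_chart_def)
  then show ?thesis
    by (simp add: smooth_in_chart_def in_chart_def[abs_def])
qed

lemma smooth_in_chart_ln:
  assumes "smooth_in_chart n c h" "\<And>p. p \<in> fst c \<Longrightarrow> h p > 0"
  shows "smooth_in_chart n c (\<lambda>p. ln (h p))"
proof -
  have "in_chart c h x > 0" if "x \<in> snd c ` fst c" for x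
    using assms(2)[OF inv_into_into[OF that]] by (simp add: in_chart_def)
  then have "smooth_on n (snd c ` fst c) (\<lambda>x. ln (in_chart c h x))"
    using c assms(1) by (simp add: smooth_on_ln smooth_in_chart_def is_chart_def)
  then show ?thesis
    by (simp add: smooth_in_chart_def in_chart_def[abs_def])
qed

lemma smooth_in_chart_sum:
  "(\<And>i. i \<in> I \<Longrightarrow> smooth_in_chart n c (h i)) \<Longrightarrow> smooth_in_chart n c (\<lambda>p. \<Sum>i\<in>I. h i p)"
  by (induction I rule: infinite_finite_induct)
    (auto intro: smooth_in_chart_const smooth_in_chart_add)

lemma smooth_in_chart_prod:
  "(\<And>i. i \<in> I \<Longrightarrow> smooth_in_chart n c (h i)) \<Longrightarrow> smooth_in_chart n c (\<lambda>p. \<Prod>i\<in>I. h i p)"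
  by (induction I rule: infinite_finite_induct)
    (auto intro: smooth_in_chart_const smooth_in_chart_mult)

text \<open>
  The Leibniz formula writes the determinant as a polynomial in the entries.
\<close>
lemma smooth_in_chart_det:
  assumes A: "\<And>p. p \<in> fst c \<Longrightarrow> A p \<in> carrier_mat m m"
    and smooth: "\<And>i j. i < m \<Longrightarrow> j < m \<Longrightarrow> smooth_in_chart n c (\<lambda>p. A p $$ (i, j))"
  shows "smooth_in_chart n c (\<lambda>p. Determinant.det (A p))"
proof (rule smooth_in_chart_cong[OF c])
  show "smooth_in_chart n c (\<lambda>p. \<Sum>\<pi> | \<pi> permutes {0..<m}. signof \<pi> * (\<Prod>i=0..<m. A p $$ (i, \<pi> i)))"
    by (intro smooth_in_chart_sum smooth_in_chart_mult smooth_in_chart_const smooth_in_chart_prod smooth)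
      (auto simp: permutes_in_image)
qed (simp add: det_def'[OF A])

text \<open>
  Cramer's rule: an entry of the inverse is a cofactor divided by the determinant, and both are
  polynomials in the entries of the matrix.
\<close>
lemma smooth_in_chart_inverse_mat:
  assumes A: "\<And>p. p \<in> fst c \<Longrightarrow> A p \<in> carrier_mat m m"
    and B: "\<And>p. p \<in> fst c \<Longrightarrow> B p \<in> carrier_mat m m \<and> B p * A p = 1\<^sub>m m"
    and smooth: "\<And>i j. i < m \<Longrightarrow> j < m \<Longrightarrow> smooth_in_chart n c (\<lambda>p. A p $$ (i, j))"
    and ij: "i < m" "j < m"
  shows "smooth_in_chart n c (\<lambda>p. B p $$ (i, j))"
proof (rule smooth_in_chart_cong[OF c])
  have det: "Determinant.det (A p) \<noteq> 0" if "p \<in> fst c" for p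
  proof -
    have "Determinant.det (B p) * Determinant.det (A p) = 1"
      using det_mult[of "B p" m "A p"] A[OF that] B[OF that] by (simp add: det_one)
    then show ?thesis by auto
  qed
  show "B p $$ (i, j) = inverse (Determinant.det (A p)) * ((- 1) ^ (j + i) * Determinant.det (mat_delete (A p) j i))"
    if p: "p \<in> fst c" for p
  proof -
    have "Determinant.det (A p) \<cdot>\<^sub>m B p = B p * (A p * adj_mat (A p))"
      using adj_mat(2)[OF A[OF p]] B[OF p] by (simp add: mult_smult_distrib[of "B p" m m "1\<^sub>m m" m] right_mult_one_mat[of "B p" m m])
    also have "\<dots> = (B p * A p) * adj_mat (A p)"
      by (rule assoc_mult_mat[symmetric]) (use adj_mat(1)[OF A[OF p]] B[OF p] A[OF p] in blast)+
    also have "\<dots> = adj_mat (A p)"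
      using adj_mat(1)[OF A[OF p]] B[OF p] by simp
    finally have "(Determinant.det (A p) \<cdot>\<^sub>m B p) $$ (i, j) = adj_mat (A p) $$ (i, j)" by simp
    then have "Determinant.det (A p) * B p $$ (i, j) = cofactor (A p) j i"
      using A[OF p] carrier_matD[of "B p" m m] B[OF p] ij by (simp add: adj_mat_def)
    then show ?thesis
      using det[OF p] by (simp add: cofactor_def field_simps)
  qed
  have entry: "smooth_in_chart n c (\<lambda>p. mat_delete (A p) j i $$ (a, b))"
    if "a < m - 1" "b < m - 1" for a b
  proof (rule smooth_in_chart_cong[OF c])
    show "smooth_in_chart n c (\<lambda>p. A p $$ (if a < j then a else Suc a, if b < i then b else Suc b))"
      using that by (intro smooth) auto
    show "mat_delete (A p) j i $$ (a, b) = A p $$ (if a < j then a else Suc a, if b < i then b else Suc b)"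
      if "p \<in> fst c" for p
      using A[OF that] \<open>a < m - 1\<close> \<open>b < m - 1\<close> by (simp add: mat_delete_def)
  qed
  show "smooth_in_chart n c (\<lambda>p. inverse (Determinant.det (A p)) *
      ((- 1) ^ (j + i) * Determinant.det (mat_delete (A p) j i)))"
    by (intro smooth_in_chart_mult smooth_in_chart_const smooth_in_chart_inverse det
        smooth_in_chart_det[OF A smooth] smooth_in_chart_det[of _ "m - 1"] mat_delete_carrier A entry)
qed

end

section \<open>Exponential and logarithm of smooth series\<close>

definition series_log :: "('m \<Rightarrow> real) fps \<Rightarrow> ('m \<Rightarrow> real) fps" where
  "series_log \<rho> = Abs_fps (\<lambda>k p. fps_nth (fps_Log (eval_at p \<rho>)) k)"

lemma series_log_exp: "series_log (series_exp f) = f"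
proof -
  have "eval_at p (series_exp f) = fps_Exp (eval_at p f)" for p
    by (rule fps_ext) (simp add: series_exp_nth)
  then show ?thesis
    by (intro fps_ext ext) (simp add: series_log_def fps_Log_Exp)
qed

lemma series_exp_log:
  assumes "positive_series \<rho>"
  shows "series_exp (series_log \<rho>) = \<rho>"
proof -
  have "eval_at p (series_log \<rho>) = fps_Log (eval_at p \<rho>)" for p
    by (rule fps_ext) (simp add: series_log_def)
  then show ?thesis
    using assms by (intro fps_ext ext) (simp add: series_exp_nth fps_Exp_Log positive_series_def)
qed

lemma positive_series_exp: "positive_series (series_exp f)"
  by (simp add: positive_series_def series_exp_nth fps_Exp_nth_0)

text \<open>
  Strong induction on the degree along the recursion for the coefficients of the exponential: the
  constant coefficient is a composite with the real exponential, and every other one is a polynomial in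
  the coefficients of \<open>f\<close> and earlier coefficients of the exponential.
\<close>
lemma smooth_series_exp:
  assumes c: "is_chart n c" and f: "\<And>k. smooth_in_chart n c (fps_nth f k)"
  shows "smooth_in_chart n c (fps_nth (series_exp f) k)"
proof (induction k rule: less_induct)
  case (less k)
  show ?case
  proof (cases k)
    case 0
    have "smooth_in_chart n c (\<lambda>p. exp (fps_nth f 0 p))"
      by (intro smooth_in_chart_exp c f)
    then show ?thesis
      by (rule smooth_in_chart_cong[OF c, rotated]) (simp add: 0 series_exp_nth fps_Exp_nth_0)
  next
    case (Suc m)
    have "smooth_in_chart n c (\<lambda>p. inverse (real (Suc m)) *
      (\<Sum>i\<le>m. real (Suc i) * (fps_nth f (Suc i) p * fps_nth (series_exp f) (m - i) p)))"
      by (intro smooth_in_chart_mult smooth_in_chart_sum smooth_in_chart_const c f less) (simp add: Suc)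
    then show ?thesis
      by (rule smooth_in_chart_cong[OF c, rotated]) (simp only: Suc series_exp_nth fps_Exp_nth_Suc eval_at_nth)
  qed
qed

text \<open>
  The same induction for the logarithm. Positivity makes the constant coefficient smooth under the real
  logarithm and lets the recursion divide by the constant coefficient of \<open>\<rho>\<close>.
\<close>
lemma smooth_series_log:
  assumes c: "is_chart n c" and \<rho>: "\<And>k. smooth_in_chart n c (fps_nth \<rho> k)"
    and pos: "positive_series \<rho>"
  shows "smooth_in_chart n c (fps_nth (series_log \<rho>) k)"
proof (induction k rule: less_induct)
  case (less k)
  have pos': "fps_nth \<rho> 0 p > 0" for p
    using pos by (simp add: positive_series_def)
  show ?case
  proof (cases k)
    case 0
    have "smooth_in_chart n c (\<lambda>p. ln (fps_nth \<rho> 0 p))"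
      by (intro smooth_in_chart_ln c \<rho> pos')
    then show ?thesis
      by (rule smooth_in_chart_cong[OF c, rotated]) (simp add: 0 series_log_def fps_Log_nth_0)
  next
    case (Suc m)
    have "smooth_in_chart n c (\<lambda>p. inverse (fps_nth \<rho> 0 p) *
      (fps_nth \<rho> (Suc m) p + - inverse (real (Suc m)) *
        (\<Sum>i<m. real (Suc i) * (fps_nth (series_log \<rho>) (Suc i) p * fps_nth \<rho> (m - i) p))))"
      using pos'
      by (intro smooth_in_chart_mult smooth_in_chart_add smooth_in_chart_sum smooth_in_chart_const
          smooth_in_chart_inverse c \<rho> less) (auto simp: Suc less_imp_neq[symmetric])
    then show ?thesis
      by (rule smooth_in_chart_cong[OF c, rotated])
        (simp only: Suc series_log_def fps_nth_Abs_fps fps_Log_nth_Suc[of "eval_at _ \<rho>" m] eval_at_nth pos')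
  qed
qed

section \<open>Musical isomorphisms\<close>

definition covec :: "nat \<Rightarrow> (nat set \<Rightarrow> real) \<Rightarrow> real vec" where
  "covec n a = vec n (\<lambda>i. a {i})"

lemma multi_indices_1: "multi_indices n (Suc 0) = (\<lambda>i. {i}) ` {..<n}"
  by (auto simp: multi_indices_def card_1_singleton_iff)

lemma mult_mat_vec_index_sum:
  assumes "A \<in> carrier_mat n n" "i < n"
  shows "(A *\<^sub>v vec n f) $ i = (\<Sum>j<n. A $$ (i, j) * f j)"
  using assms by (simp add: scalar_prod_def atLeast0LessThan)

lemma det_submatrix_singletons:
  assumes "A \<in> carrier_mat n n" "i < n" "j < n"
  shows "Determinant.det (submatrix A {i} {j}) = A $$ (i, j)"
proof -
  have [simp]: "{a. a < n \<and> a = b} = {b}" if "b < n" for b :: nat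
    using that by auto
  have "pick {b} 0 = b" for b
    by (simp add: Least_equality)
  then show ?thesis
    using assms by (subst det_single) (auto simp: submatrix_def)
qed

lemma jacobian_carrier: "jacobian n c c' p \<in> carrier_mat n n"
  by (simp add: jacobian_def)

text \<open>
  For one-forms the minors in the transformation law are \<open>1 \<times> 1\<close>, and the law becomes
  multiplication of the component vector by the transposed Jacobian matrix. In this form the compatibility of
  the musical isomorphisms with coordinate changes is a computation with matrices.
\<close>
lemma forms_1_iff:
  "X \<in> forms M 1 \<longleftrightarrow>
     (\<forall>c p I. \<not> (c \<in> atlas M \<and> p \<in> fst c \<and> I \<in> multi_indices (mdim M) 1) \<longrightarrow> X c p I = 0) \<and>
     (\<forall>c\<in>atlas M. \<forall>i<mdim M. smooth_in_chart (mdim M) c (\<lambda>p. X c p {i})) \<and>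
     (\<forall>c\<in>atlas M. \<forall>c'\<in>atlas M. \<forall>p\<in>fst c \<inter> fst c'.
        covec (mdim M) (X c p) =
          transpose_mat (jacobian (mdim M) c c' p) *\<^sub>v covec (mdim M) (X c' p))"
proof -
  have "(\<forall>I\<in>multi_indices (mdim M) 1. X c p I = (\<Sum>J\<in>multi_indices (mdim M) 1.
            Determinant.det (submatrix (jacobian (mdim M) c c' p) J I) * X c' p J)) \<longleftrightarrow>
      covec (mdim M) (X c p) = transpose_mat (jacobian (mdim M) c c' p) *\<^sub>v covec (mdim M) (X c' p)"
    (is "?L \<longleftrightarrow> ?R") for c c' p
  proof -
    note J = jacobian_carrier[of "mdim M" c c' p]
    have "?L \<longleftrightarrow> (\<forall>i<mdim M. X c p {i} = (\<Sum>j<mdim M. jacobian (mdim M) c c' p $$ (j, i) * X c' p {j}))"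
      by (simp add: multi_indices_1 sum.reindex det_submatrix_singletons[OF J]) (simp add: Ball_def)
    also have "\<dots> \<longleftrightarrow> (\<forall>i<mdim M. X c p {i} =
        (transpose_mat (jacobian (mdim M) c c' p) *\<^sub>v covec (mdim M) (X c' p)) $ i)"
      using J by (simp add: covec_def mult_mat_vec_index_sum[where n = "mdim M"] del: index_mult_mat_vec)
    also have "\<dots> \<longleftrightarrow> ?R"
      using J by (simp add: covec_def vec_eq_iff del: index_mult_mat_vec)
    finally show ?thesis .
  qed
  then show ?thesis
    unfolding forms_def mem_Collect_eq by (simp add: multi_indices_1) (simp add: Ball_def)
qed

lemma vector_fields_iff:
  "u \<in> vector_fields M \<longleftrightarrow>
     (\<forall>c p i. \<not> (c \<in> atlas M \<and> p \<in> fst c \<and> i < mdim M) \<longrightarrow> u c p i = 0) \<and>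
     (\<forall>c\<in>atlas M. \<forall>i<mdim M. smooth_in_chart (mdim M) c (\<lambda>p. u c p i)) \<and>
     (\<forall>c\<in>atlas M. \<forall>c'\<in>atlas M. \<forall>p\<in>fst c \<inter> fst c'.
        vec (mdim M) (u c' p) = jacobian (mdim M) c c' p *\<^sub>v vec (mdim M) (u c p))"
proof -
  have "(\<forall>i<mdim M. u c' p i = (\<Sum>j<mdim M. jacobian (mdim M) c c' p $$ (i, j) * u c p j)) \<longleftrightarrow>
      vec (mdim M) (u c' p) = jacobian (mdim M) c c' p *\<^sub>v vec (mdim M) (u c p)" for c c' p
    using jacobian_carrier[of "mdim M" c c' p]
    by (simp add: vec_eq_iff mult_mat_vec_index_sum[OF jacobian_carrier] del: index_mult_mat_vec)
  then show ?thesis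
    by (simp add: vector_fields_def)
qed

locale riemannian =
  fixes M :: "('m::{t2_space, second_countable_topology}) oriented_riemannian"
  assumes manifold: "oriented_riemannian_manifold M"
begin

abbreviation "n \<equiv> mdim M"

lemma chart: "c \<in> atlas M \<Longrightarrow> is_chart n c"
  using manifold by (simp add: oriented_riemannian_manifold_def oriented_smooth_atlas_def)

lemma metric_carrier: "c \<in> atlas M \<Longrightarrow> p \<in> fst c \<Longrightarrow> metric M c p \<in> carrier_mat n n"
  using manifold unfolding oriented_riemannian_manifold_def riemannian_metric_def by blast

lemma metric_smooth:
  "c \<in> atlas M \<Longrightarrow> i < n \<Longrightarrow> j < n \<Longrightarrow> smooth_in_chart n c (\<lambda>p. metric M c p $$ (i, j))"
  using manifold unfolding oriented_riemannian_manifold_def riemannian_metric_def by blast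

lemma metric_transform:
  assumes "c \<in> atlas M" "c' \<in> atlas M" "p \<in> fst c \<inter> fst c'"
  shows "metric M c p = transpose_mat (jacobian n c c' p) * metric M c' p * jacobian n c c' p"
  using manifold assms unfolding oriented_riemannian_manifold_def riemannian_metric_def by blast

text \<open>
  A positive definite matrix has trivial kernel.
\<close>
lemma det_metric:
  assumes "c \<in> atlas M" "p \<in> fst c"
  shows "Determinant.det (metric M c p) \<noteq> 0"
proof
  assume "Determinant.det (metric M c p) = 0"
  then obtain v where v: "v \<in> carrier_vec n" "v \<noteq> 0\<^sub>v n" "metric M c p *\<^sub>v v = 0\<^sub>v n"
    using det_0_iff_vec_prod_zero_field[OF metric_carrier[OF assms]] by blast
  then have "v \<bullet> (metric M c p *\<^sub>v v) > 0"
    using manifold assms v(1,2) unfolding oriented_riemannian_manifold_def riemannian_metric_def by blast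
  then show False
    using v by simp
qed

lemma inverse_metric:
  assumes "c \<in> atlas M" "p \<in> fst c"
  shows "inverse_metric M c p \<in> carrier_mat n n"
    and "metric M c p * inverse_metric M c p = 1\<^sub>m n"
    and "inverse_metric M c p * metric M c p = 1\<^sub>m n"
proof -
  note G = metric_carrier[OF assms]
  have "metric M c p \<in> Units (ring_mat TYPE(real) n ())"
    using det_non_zero_imp_unit[OF G det_metric[OF assms]] .
  then obtain B where "mat_inverse (metric M c p) = Some B"
    using mat_inverse(1)[OF G] by fastforce
  then show "inverse_metric M c p \<in> carrier_mat n n"
    "metric M c p * inverse_metric M c p = 1\<^sub>m n"
    "inverse_metric M c p * metric M c p = 1\<^sub>m n"
    using mat_inverse(2)[OF G] by (auto simp: inverse_metric_def)
qed

lemma inverse_metric_smooth: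
  assumes "c \<in> atlas M" "i < n" "j < n"
  shows "smooth_in_chart n c (\<lambda>p. inverse_metric M c p $$ (i, j))"
  by (rule smooth_in_chart_inverse_mat[OF chart, where A = "metric M c" and m = n])
    (use assms in \<open>auto simp: metric_carrier inverse_metric intro: metric_smooth\<close>)

lemma covec_flat:
  assumes "c \<in> atlas M" "p \<in> fst c"
  shows "covec n (flat M u c p) = metric M c p *\<^sub>v vec n (u c p)"
  using assms metric_carrier[OF assms]
  by (intro eq_vecI) (auto simp: covec_def flat_def multi_indices_1 mult_mat_vec_index_sum simp del: index_mult_mat_vec)

lemma vec_sharp:
  assumes "c \<in> atlas M" "p \<in> fst c"
  shows "vec n (sharp M X c p) = inverse_metric M c p *\<^sub>v covec n (X c p)"
  using assms inverse_metric(1)[OF assms]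
  by (intro eq_vecI) (auto simp: covec_def sharp_def mult_mat_vec_index_sum simp del: index_mult_mat_vec)

lemma flat_sharp:
  assumes "X \<in> forms M 1"
  shows "flat M (sharp M X) = X"
proof (intro ext)
  fix c p I
  show "flat M (sharp M X) c p I = X c p I"
  proof (cases "c \<in> atlas M \<and> p \<in> fst c \<and> I \<in> multi_indices n 1")
    case True
    then obtain i where I: "i < n" "I = {i}" and cp: "c \<in> atlas M" "p \<in> fst c"
      by (auto simp: multi_indices_1)
    have "covec n (flat M (sharp M X) c p) = covec n (X c p)"
      unfolding covec_flat[OF cp] vec_sharp[OF cp]
      using metric_carrier[OF cp] inverse_metric[OF cp]
      by (subst assoc_mult_mat_vec[symmetric]) (auto simp: covec_def)
    then have "covec n (flat M (sharp M X) c p) $ i = covec n (X c p) $ i" by simp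
    then show ?thesis
      using I by (simp add: covec_def)
  next
    case False
    then have "X c p I = 0" using assms unfolding forms_1_iff by blast
    then show ?thesis using False by (auto simp: flat_def)
  qed
qed

lemma sharp_flat:
  assumes "u \<in> vector_fields M"
  shows "sharp M (flat M u) = u"
proof (intro ext)
  fix c p i
  show "sharp M (flat M u) c p i = u c p i"
  proof (cases "c \<in> atlas M \<and> p \<in> fst c \<and> i < n")
    case True
    then have i: "i < n" and cp: "c \<in> atlas M" "p \<in> fst c"
      by auto
    have "vec n (sharp M (flat M u) c p) = vec n (u c p)"
      unfolding covec_flat[OF cp] vec_sharp[OF cp]
      using metric_carrier[OF cp] inverse_metric[OF cp]
      by (subst assoc_mult_mat_vec[symmetric]) auto
    then have "vec n (sharp M (flat M u) c p) $ i = vec n (u c p) $ i" by simp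
    then show ?thesis
      using i by simp
  next
    case False
    then have "u c p i = 0" using assms unfolding vector_fields_iff by blast
    then show ?thesis using False by (auto simp: sharp_def)
  qed
qed

text \<open>
  With \<open>G\<close>, \<open>G'\<close> the Gram matrices in two charts and \<open>J\<close> the Jacobian matrix of the coordinate change,
  the laws \<open>G = J\<^sup>T * G' * J\<close> and \<open>u' = J * u\<close> give \<open>G * u = J\<^sup>T * (G' * u')\<close>, which is the law for
  one-forms.
\<close>
lemma flat_in_forms:
  assumes u: "u \<in> vector_fields M"
  shows "flat M u \<in> forms M 1"
  unfolding forms_1_iff
proof (intro conjI ballI allI impI)
  fix c i assume c: "c \<in> atlas M" and i: "i < n"
  have "smooth_in_chart n c (\<lambda>p. \<Sum>j<n. metric M c p $$ (i, j) * u c p j)"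
    using u c i unfolding vector_fields_iff
    by (intro smooth_in_chart_sum smooth_in_chart_mult chart metric_smooth) auto
  then show "smooth_in_chart n c (\<lambda>p. flat M u c p {i})"
    by (rule smooth_in_chart_cong[OF chart[OF c], rotated]) (use c i in \<open>auto simp: flat_def multi_indices_1\<close>)
next
  fix c c' p assume cc: "c \<in> atlas M" "c' \<in> atlas M" "p \<in> fst c \<inter> fst c'"
  let ?J = "jacobian n c c' p"
  note J = jacobian_carrier[of n c c' p]
  have G': "metric M c' p \<in> carrier_mat n n"
    using metric_carrier cc by blast
  have "covec n (flat M u c p) = ?J\<^sup>T * metric M c' p * ?J *\<^sub>v vec n (u c p)"
    using covec_flat metric_transform[OF cc] cc by simp
  also have "\<dots> = ?J\<^sup>T *\<^sub>v (metric M c' p *\<^sub>v (?J *\<^sub>v vec n (u c p)))"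
    using J G' by (simp add: assoc_mult_mat_vec[where n\<^sub>1 = n and n\<^sub>2 = n and n\<^sub>3 = n])
  also have "?J *\<^sub>v vec n (u c p) = vec n (u c' p)"
    using u cc unfolding vector_fields_iff by metis
  finally show "covec n (flat M u c p) = ?J\<^sup>T *\<^sub>v covec n (flat M u c' p)"
    using covec_flat cc by simp
qed (auto simp: flat_def)

lemma jacobian_transpose_cancel:
  assumes cc: "c \<in> atlas M" "c' \<in> atlas M" "p \<in> fst c \<inter> fst c'"
    and v: "v \<in> carrier_vec n" "w \<in> carrier_vec n"
    and eq: "(jacobian n c c' p)\<^sup>T *\<^sub>v v = (jacobian n c c' p)\<^sup>T *\<^sub>v w"
  shows "v = w"
proof -
  let ?J = "jacobian n c c' p"
  have JT: "?J\<^sup>T \<in> carrier_mat n n"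
    by (simp add: jacobian_carrier)
  have "Determinant.det ?J > 0"
    using manifold cc by (simp add: oriented_riemannian_manifold_def oriented_smooth_atlas_def)
  then have "Determinant.det (?J\<^sup>T) \<noteq> 0"
    by (simp add: det_transpose[OF jacobian_carrier])
  moreover have "?J\<^sup>T *\<^sub>v (v - w) = 0\<^sub>v n"
    using v eq JT by (simp add: mult_minus_distrib_mat_vec[OF JT])
  moreover have "v - w \<in> carrier_vec n"
    using v by simp
  ultimately have "v - w = 0\<^sub>v n"
    using det_0_iff_vec_prod_zero_field[OF JT] by blast
  then have "v $ i = w $ i" if "i < n" for i
    using v that by (auto simp: vec_eq_iff)
  then show ?thesis
    using v by auto
qed

text \<open>
  Put \<open>u = sharp X\<close>, so that \<open>G * u = X\<close>. The laws for \<open>X\<close> and \<open>G\<close> give \<open>J\<^sup>T * (G' * (J * u)) = J\<^sup>T * X'\<close>.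
  Cancelling \<open>J\<^sup>T\<close>, which is invertible as the atlas is oriented, and multiplying by the inverse of \<open>G'\<close>
  yields \<open>J * u = u'\<close>.
\<close>
lemma sharp_in_vector_fields:
  assumes X: "X \<in> forms M 1"
  shows "sharp M X \<in> vector_fields M"
  unfolding vector_fields_iff
proof (intro conjI ballI allI impI)
  fix c i assume c: "c \<in> atlas M" and i: "i < n"
  have "smooth_in_chart n c (\<lambda>p. \<Sum>j<n. inverse_metric M c p $$ (i, j) * X c p {j})"
    using X c i unfolding forms_1_iff
    by (intro smooth_in_chart_sum smooth_in_chart_mult chart inverse_metric_smooth) auto
  then show "smooth_in_chart n c (\<lambda>p. sharp M X c p i)"
    by (rule smooth_in_chart_cong[OF chart[OF c], rotated]) (use c i in \<open>auto simp: sharp_def\<close>)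
next
  fix c c' p assume cc: "c \<in> atlas M" "c' \<in> atlas M" "p \<in> fst c \<inter> fst c'"
  let ?J = "jacobian n c c' p" and ?u = "sharp M X"
  note J = jacobian_carrier[of n c c' p]
  have cp: "p \<in> fst c" "p \<in> fst c'" using cc by auto
  note G' = metric_carrier[OF cc(2) cp(2)] and Gi = inverse_metric[OF cc(2) cp(2)]
  have lower: "covec n (X b p) = metric M b p *\<^sub>v vec n (?u b p)" if "b \<in> atlas M" "p \<in> fst b" for b
    using covec_flat[OF that, of ?u] flat_sharp[OF X] by simp
  have "?J\<^sup>T *\<^sub>v (metric M c' p *\<^sub>v (?J *\<^sub>v vec n (?u c p))) = covec n (X c p)"
    unfolding lower[OF cc(1) cp(1)] metric_transform[OF cc]
    using J G' by (simp add: assoc_mult_mat_vec[where n\<^sub>1 = n and n\<^sub>2 = n and n\<^sub>3 = n])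
  also have "\<dots> = ?J\<^sup>T *\<^sub>v covec n (X c' p)"
    using X cc unfolding forms_1_iff by blast
  finally have "metric M c' p *\<^sub>v (?J *\<^sub>v vec n (?u c p)) = covec n (X c' p)"
    using jacobian_transpose_cancel[OF cc] J G' by (auto simp: covec_def)
  then have "inverse_metric M c' p *\<^sub>v covec n (X c' p)
      = (inverse_metric M c' p * metric M c' p) *\<^sub>v (?J *\<^sub>v vec n (?u c p))"
    using Gi(1) G' J by (simp add: assoc_mult_mat_vec[where n\<^sub>1 = n and n\<^sub>2 = n and n\<^sub>3 = n])
  then show "vec n (?u c' p) = ?J *\<^sub>v vec n (?u c p)"
    using vec_sharp[OF cc(2) cp(2), of X] Gi(3) J by simp
qed (auto simp: sharp_def)

end

section \<open>The correspondence\<close>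

lemma flat_add: "flat M (u + v) = flat M u + flat M v"
  by (intro ext) (simp add: flat_def algebra_simps sum.distrib)

lemma flat_sum: "flat M (\<Sum>i\<in>I. u i) = (\<Sum>i\<in>I. flat M (u i))"
proof -
  have "flat M 0 = 0" by (intro ext) (simp add: flat_def)
  then show ?thesis
    by (induction I rule: infinite_finite_induct) (simp_all add: flat_add)
qed

lemma flat_fun_smult: "flat M (fun_smult h u) = fun_smult h (flat M u)"
  by (intro ext) (simp add: flat_def fun_smult_def sum_distrib_left mult.left_commute)

text \<open>
  This identity matches the two equations. The divergence is the codifferential after lowering the
  index, and lowering the index is linear over functions, so it commutes with the multiplication by \<open>\<rho>\<close>.
\<close>
lemma series_divergence:
  "series_map (divergence M) (series_smult \<rho> u) =
     series_map (codiff M 1) (series_smult \<rho> (series_map (flat M) u))"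
  by (rule fps_ext) (simp add: series_map_def series_smult_def divergence_def flat_sum flat_fun_smult)

theorem lemma5p1:
  fixes M :: "('m::{t2_space, second_countable_topology}) oriented_riemannian"
  assumes "oriented_riemannian_manifold M"
    and "compact (UNIV :: 'm set)"
    and "connected (UNIV :: 'm set)"
    and "total_volume M = 1"
  shows "bij_betw (\<lambda>(f, X). (series_exp f, series_map (sharp M) X))
           (homotopy_solutions M) (mass_solutions M)"
proof -
  interpret riemannian M
    using assms(1) by unfold_locales
  have flat_sharp_series: "series_map (flat M) (series_map (sharp M) X) = X"
    if "X \<in> series_over (forms M 1)" for X
    using that by (intro fps_ext) (simp add: series_map_def series_over_def flat_sharp)
  have sharp_flat_series: "series_map (sharp M) (series_map (flat M) u) = u"
    if "u \<in> series_over (vector_fields M)" for u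
    using that by (intro fps_ext) (simp add: series_map_def series_over_def sharp_flat)
  show ?thesis
  proof (rule bij_betw_byWitness[where f' = "\<lambda>(\<rho>, u). (series_log \<rho>, series_map (flat M) u)"])
    show "\<forall>a\<in>homotopy_solutions M. (case case a of (f, X) \<Rightarrow> (series_exp f, series_map (sharp M) X) of
        (\<rho>, u) \<Rightarrow> (series_log \<rho>, series_map (flat M) u)) = a"
      by (auto simp: homotopy_solutions_def series_log_exp flat_sharp_series)
    show "\<forall>b\<in>mass_solutions M. (case case b of (\<rho>, u) \<Rightarrow> (series_log \<rho>, series_map (flat M) u) of
        (f, X) \<Rightarrow> (series_exp f, series_map (sharp M) X)) = b"
      by (auto simp: mass_solutions_def series_exp_log sharp_flat_series)
    show "(\<lambda>(f, X). (series_exp f, series_map (sharp M) X)) ` homotopy_solutions M \<subseteq> mass_solutions M"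
    proof clarify
      fix f X assume fX: "(f, X) \<in> homotopy_solutions M"
      have "series_exp f \<in> series_over (smooth_functions M)"
        using fX smooth_series_exp[OF chart]
        by (simp add: homotopy_solutions_def series_over_def smooth_functions_def)
      moreover have "series_map (sharp M) X \<in> series_over (vector_fields M)"
        using fX sharp_in_vector_fields
        by (simp add: homotopy_solutions_def series_over_def series_map_def)
      ultimately show "(series_exp f, series_map (sharp M) X) \<in> mass_solutions M"
        using fX
        by (simp add: homotopy_solutions_def mass_solutions_def positive_series_exp
            series_divergence flat_sharp_series)
    qed
    show "(\<lambda>(\<rho>, u). (series_log \<rho>, series_map (flat M) u)) ` mass_solutions M \<subseteq> homotopy_solutions M"
    proof clarify
      fix \<rho> u assume \<rho>u: "(\<rho>, u) \<in> mass_solutions M"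
      have "series_log \<rho> \<in> series_over (smooth_functions M)"
        using \<rho>u smooth_series_log[OF chart]
        by (simp add: mass_solutions_def series_over_def smooth_functions_def)
      moreover have "series_map (flat M) u \<in> series_over (forms M 1)"
        using \<rho>u flat_in_forms
        by (simp add: mass_solutions_def series_over_def series_map_def)
      ultimately show "(series_log \<rho>, series_map (flat M) u) \<in> homotopy_solutions M"
        using \<rho>u
        by (simp add: homotopy_solutions_def mass_solutions_def series_exp_log series_divergence)
    qed
  qed
qed

end
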